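(* Let $f:\mathbb{R}^n\to\mathbb{R}$ and $G:\mathbb{R}^n\to\mathbb{S}^m$ be continuously differentiable, and let $\bar x\in\mathcal{F}$ be a point that satisfies the AKKT condition and satisfies seq-CPLD. Then $\bar x$ satisfies the KKT conditions.
   Context: $\mathbb{S}^m$ is the space of real symmetric $m\times m$ matrices with inner product $\langle M,N\rangle=\mathrm{trace}(MN)$ and Frobenius norm; $\mathbb{S}^m_+$ is the cone of positive semidefinite matrices; $M\succeq 0$ means $M\in\mathbb{S}^m_+$. The problem is: minimize $f(x)$ over $x\in\mathbb{R}^n$ subject to $G(x)\succeq0$; $\mathcal{F}=\{x: G(x)\succeq 0\}$. $D_{x_i}G(x)$ is the $i$-th partial derivative of $G$ and $DG(x)^*$ is the adjoint of the derivative. $L(x,Y)=f(x)-\langle G(x),Y\rangle$, so $\nabla_xL(x,Y)=\nabla f(x)-DG(x)^*[Y]$. KKT conditions at $\bar x\in\mathcal{F}$: there exists $\bar Y\succeq0$ with $\nabla_xL(\bar x,\bar Y)=0$ and $\langle G(\bar x),\bar Y\rangle=0$. AKKT condition at $\bar x\in\mathcal{F}$: there exist sequences $x^k\to\bar x$, $\{Y^k\}\subseteq\mathbb{S}^m_+$, $\{\delta^k\}\subseteq\mathbb{R}^n$, $\{\Delta^k\}\subseteq\mathbb{S}^m$ such that, for every $k$, $\nabla_xL(x^k,Y^k)=\delta^k$, $G(x^k)+\Delta^k\succeq0$ and $\langle G(x^k)+\Delta^k,Y^k\rangle=0$; and $\Delta^k\to0$, $\delta^k\to0$. Eigenvalues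 of $M\in\mathbb{S}^m$ are ordered $\lambda_1(M)\ge\dots\ge\lambda_m(M)$. For $0\le r<m$, $\mathcal{E}_r(M)$ is the set of $E\in\mathbb{R}^{m\times(m-r)}$ with $E^\top E=I_{m-r}$ and $ME=E\,\mathrm{Diag}(\lambda_{r+1}(M),\dots,\lambda_m(M))$. For $E$ with columns $e_1,\dots,e_{m-r}$, $v_{ii}(x,E)=[e_i^\top D_{x_1}G(x)e_i,\dots,e_i^\top D_{x_n}G(x)e_i]^\top\in\mathbb{R}^n$. A finite family $\{z_i\}_{i\in J}$ is positively linearly dependent if there are $\alpha_i\ge0$, $i \in J$, not all zero, with $\sum_{i\in J}\alpha_iz_i=0$. Seq-CPLD at $\bar x\in\mathcal{F}$, with $r=\mathrm{rank}\,G(\bar x)$: either $r=m$ or, for all sequences $x^k\to\bar x$ and $\{\Delta^k\}\subseteq\mathbb{S}^m$ with $\Delta^k\to0$, there exist an infinite set $I\subseteq\mathbb{N}$ and matrices $E^k\in\mathcal{E}_r(G(x^k)+\Delta^k)$, $k\in I$, with $\{E^k\}_{k\in I}$ convergent to some $\bar E$, such that for every $J\subseteq\{1,\dots,m-r\}$: if $\{v_{ii}(\bar x,\bar E)\}_{i\in J}$ is positively linearly dependent, then $\{v_{ii}(x^k,E^k)\}_{i\in J}$ is linearly dependent for all sufficiently large $k\in I$. *)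

theory Defs
  imports "HOL-Analysis.Analysis"
begin

definition continuously_differentiable ::
    "('a::real_normed_vector \<Rightarrow> 'b::real_normed_vector) \<Rightarrow> bool" where
  "continuously_differentiable F \<longleftrightarrow>
     (\<exists>F' :: 'a \<Rightarrow> 'a \<Rightarrow>\<^sub>L 'b.
        (\<forall>x. (F has_derivative blinfun_apply (F' x)) (at x)) \<and> continuous_on UNIV F')"

definition symmetric_matrix :: "real^'m^'m \<Rightarrow> bool" where
  "symmetric_matrix M \<longleftrightarrow> transpose M = M"

definition psd :: "real^'m^'m \<Rightarrow> bool" where
  "psd M \<longleftrightarrow> symmetric_matrix M \<and> (\<forall>v. 0 \<le> v \<bullet> (M *v v))"

definition sym_inner :: "real^'m^'m \<Rightarrow> real^'m^'m \<Rightarrow> real" where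
  "sym_inner M N = trace (M ** N)"

text \<open>On symmetric matrices this is the library inner product of \<^typ>\<open>real^'m^'m\<close>, whose
  induced norm is the Frobenius norm; limits of matrices are therefore taken in the usual sense.\<close>

lemma sym_inner_eq_inner:
  assumes "symmetric_matrix N"
  shows "sym_inner M N = M \<bullet> N"
proof -
  have "N $ j $ i = N $ i $ j" for i j
    using assms unfolding symmetric_matrix_def transpose_def by (metis vec_lambda_beta)
  then show ?thesis
    by (simp add: sym_inner_def trace_def matrix_matrix_mult_def inner_vec_def)
qed

definition feasible :: "(real^'n \<Rightarrow> real^'m^'m) \<Rightarrow> (real^'n) set" where
  "feasible G = {x. psd (G x)}"

definition lagrangian ::
    "(real^'n \<Rightarrow> real) \<Rightarrow> (real^'n \<Rightarrow> real^'m^'m) \<Rightarrow> real^'n \<Rightarrow> real^'m^'m \<Rightarrow> real" where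
  "lagrangian f G x Y = f x - sym_inner (G x) Y"

text \<open>The gradient of the Lagrangian with respect to the first argument is expressed below by the
  library relation \<^const>\<open>gderiv\<close>; it is the difference of the gradient of \<open>f\<close> and the
  adjoint derivative of \<open>G\<close> applied to \<open>Y\<close>.\<close>

lemma gderiv_lagrangian:
  assumes f: "GDERIV f x :> df" and G: "G differentiable (at x)" and Y: "symmetric_matrix Y"
  shows "GDERIV (\<lambda>x. lagrangian f G x Y) x :> d \<longleftrightarrow>
           d = df - adjoint (frechet_derivative G (at x)) Y"
proof -
  let ?D = "frechet_derivative G (at x)"
  have D: "(G has_derivative ?D) (at x)"
    using G frechet_derivative_works by blast
  have L: "((\<lambda>x. lagrangian f G x Y) has_derivative (\<lambda>h. h \<bullet> (df - adjoint ?D Y))) (at x)"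
    unfolding lagrangian_def sym_inner_eq_inner[OF Y]
    using has_derivative_diff[OF f[unfolded gderiv_def] has_derivative_inner_left[OF D, of Y]]
    by (simp add: inner_diff_right adjoint_works[OF has_derivative_linear[OF D]])
  show ?thesis
  proof
    assume "GDERIV (\<lambda>x. lagrangian f G x Y) x :> d"
    then have "(\<lambda>h. h \<bullet> d) = (\<lambda>h. h \<bullet> (df - adjoint ?D Y))"
      unfolding gderiv_def using L has_derivative_unique by blast
    then show "d = df - adjoint ?D Y"
      by (metis vector_eq_rdot inner_commute)
  next
    assume "d = df - adjoint ?D Y"
    then show "GDERIV (\<lambda>x. lagrangian f G x Y) x :> d"
      using L by (simp add: gderiv_def)
  qed
qed

definition kkt ::
    "(real^'n \<Rightarrow> real) \<Rightarrow> (real^'n \<Rightarrow> real^'m^'m) \<Rightarrow> real^'n \<Rightarrow> bool" where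
  "kkt f G xbar \<longleftrightarrow> xbar \<in> feasible G \<and>
     (\<exists>Y. psd Y \<and> GDERIV (\<lambda>x. lagrangian f G x Y) xbar :> 0 \<and> sym_inner (G xbar) Y = 0)"

definition akkt ::
    "(real^'n \<Rightarrow> real) \<Rightarrow> (real^'n \<Rightarrow> real^'m^'m) \<Rightarrow> real^'n \<Rightarrow> bool" where
  "akkt f G xbar \<longleftrightarrow> xbar \<in> feasible G \<and>
     (\<exists>(x :: nat \<Rightarrow> real^'n) (Y :: nat \<Rightarrow> real^'m^'m) (\<delta> :: nat \<Rightarrow> real^'n) (\<Delta> :: nat \<Rightarrow> real^'m^'m).
        x \<longlonglongrightarrow> xbar \<and> (\<forall>k. psd (Y k)) \<and> (\<forall>k. symmetric_matrix (\<Delta> k)) \<and>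
        (\<forall>k. GDERIV (\<lambda>z. lagrangian f G z (Y k)) (x k) :> \<delta> k \<and>
             psd (G (x k) + \<Delta> k) \<and>
             sym_inner (G (x k) + \<Delta> k) (Y k) = 0) \<and>
        \<Delta> \<longlonglongrightarrow> 0 \<and> \<delta> \<longlonglongrightarrow> 0)"

definition charpoly :: "real^'m^'m \<Rightarrow> real poly" where
  "charpoly M = det (\<chi> i j. (if i = j then [:0, 1:] else 0) - [:M $ i $ j:])"

text \<open>The eigenvalues of a symmetric matrix, counted with multiplicity and in nonincreasing order;
  the index ranges over \<open>1, \<dots>, CARD('m)\<close>.\<close>

definition eigval :: "nat \<Rightarrow> real^'m^'m \<Rightarrow> real" where
  "eigval i M = rev (sorted_list_of_multiset (proots (charpoly M))) ! (i - 1)"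

text \<open>A matrix with \<open>m\<close> rows and \<open>m - r\<close> columns is represented by the function mapping the column
  index in \<open>{1..m - r}\<close> to the column. The values of this function at other indices are irrelevant.\<close>

definition eigvec_matrices :: "nat \<Rightarrow> real^'m^'m \<Rightarrow> (nat \<Rightarrow> real^'m) set" where
  "eigvec_matrices r M =
     {E. (\<forall>i\<in>{1..CARD('m) - r}. \<forall>j\<in>{1..CARD('m) - r}. E i \<bullet> E j = (if i = j then 1 else 0)) \<and>
         (\<forall>i\<in>{1..CARD('m) - r}. M *v E i = eigval (r + i) M *\<^sub>R E i)}"

definition partial_deriv :: "(real^'n \<Rightarrow> real^'m^'m) \<Rightarrow> 'n \<Rightarrow> real^'n \<Rightarrow> real^'m^'m" where
  "partial_deriv G l x = frechet_derivative G (at x) (axis l 1)"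

definition vdiag :: "(real^'n \<Rightarrow> real^'m^'m) \<Rightarrow> real^'n \<Rightarrow> (nat \<Rightarrow> real^'m) \<Rightarrow> nat \<Rightarrow> real^'n" where
  "vdiag G x E i = (\<chi> l. E i \<bullet> (partial_deriv G l x *v E i))"

text \<open>Dependence of indexed families rather than of sets: repeated vectors count.\<close>

definition lin_dep :: "'i set \<Rightarrow> ('i \<Rightarrow> 'a::real_vector) \<Rightarrow> bool" where
  "lin_dep J z \<longleftrightarrow> (\<exists>\<alpha>. (\<exists>i\<in>J. \<alpha> i \<noteq> 0) \<and> (\<Sum>i\<in>J. \<alpha> i *\<^sub>R z i) = 0)"

definition pos_lin_dep :: "'i set \<Rightarrow> ('i \<Rightarrow> 'a::real_vector) \<Rightarrow> bool" where
  "pos_lin_dep J z \<longleftrightarrow>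
     (\<exists>\<alpha>. (\<forall>i\<in>J. 0 \<le> \<alpha> i) \<and> (\<exists>i\<in>J. \<alpha> i \<noteq> 0) \<and> (\<Sum>i\<in>J. \<alpha> i *\<^sub>R z i) = 0)"

definition along :: "nat set \<Rightarrow> nat filter" where
  "along I = inf sequentially (principal I)"

definition seq_cpld :: "(real^'n \<Rightarrow> real^'m^'m) \<Rightarrow> real^'n \<Rightarrow> bool" where
  "seq_cpld G xbar \<longleftrightarrow> xbar \<in> feasible G \<and>
     (let m = CARD('m); r = rank (G xbar) in
      r = m \<or>
      (\<forall>(x :: nat \<Rightarrow> real^'n) (\<Delta> :: nat \<Rightarrow> real^'m^'m).
         x \<longlonglongrightarrow> xbar \<and> (\<forall>k. symmetric_matrix (\<Delta> k)) \<and> \<Delta> \<longlonglongrightarrow> 0 \<longrightarrow>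
         (\<exists>I E Ebar.
            infinite I \<and>
            (\<forall>k\<in>I. E k \<in> eigvec_matrices r (G (x k) + \<Delta> k)) \<and>
            (\<forall>i\<in>{1..m - r}. ((\<lambda>k. E k i) \<longlongrightarrow> Ebar i) (along I)) \<and>
            (\<forall>J \<subseteq> {1..m - r}.
               pos_lin_dep J (vdiag G xbar Ebar) \<longrightarrow>
               (\<forall>\<^sub>F k in along I. lin_dep J (vdiag G (x k) (E k)))))))"

end

theory Submission
  imports Defs
begin

text \<open>Let \<open>M k = G (x k) + \<Delta> k\<close> and \<open>Y k\<close> come from the AKKT condition. Both are positive semidefinite
  with \<open>\<langle>M k, Y k\<rangle> = 0\<close>, so \<open>M k Y k = 0\<close>. The matrices \<open>E k\<close> that seq-CPLD provides for \<open>M k\<close> need not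
  diagonalise \<open>Y k\<close>, because \<open>M k\<close> may have repeated eigenvalues. Therefore seq-CPLD is applied to the
  perturbation \<open>\<Delta> k - t k Y k\<close> with \<open>t k > 0\<close> and \<open>t k Y k \<longlonglongrightarrow> 0\<close>: every eigenvector of \<open>M k - t k Y k\<close>
  with eigenvalue \<open>\<lambda>\<close> is an eigenvector of \<open>Y k\<close> with eigenvalue \<open>max 0 (- \<lambda>) / t k\<close>. For large \<open>k\<close> the
  top \<open>r\<close> eigenvalues are nonnegative, so \<open>Y k\<close> is a nonnegative combination of the matrices
  \<open>e e\<^sup>T\<close> over the columns \<open>e\<close> of \<open>E k\<close>, and its image under the adjoint derivative is the same
  combination of the vectors \<open>v\<^sub>i\<^sub>i\<close>. Caratheodory's lemma makes the vectors with
  nonzero coefficients linearly independent, with a fixed index set \<open>J\<close> along a subsequence. Dividing by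
  the sum of the coefficients and passing to the limit, unbounded coefficients would give a positive
  linear dependence at \<open>xbar\<close>, hence a linear dependence at \<open>x k\<close>; bounded ones converge to a KKT
  multiplier.\<close>

section \<open>Spectral theory of symmetric matrices\<close>

definition orthonormal_set :: "'a::real_inner set \<Rightarrow> bool" where
  "orthonormal_set B \<longleftrightarrow> (\<forall>a\<in>B. \<forall>b\<in>B. a \<bullet> b = (if a = b then 1 else 0))"

lemma orthonormal_set_norm: "orthonormal_set B \<Longrightarrow> b \<in> B \<Longrightarrow> norm b = 1"
  by (simp add: orthonormal_set_def norm_eq_sqrt_inner)

lemma orthonormal_set_pairwise: "orthonormal_set B \<Longrightarrow> pairwise orthogonal B"
  by (simp add: orthonormal_set_def pairwise_def orthogonal_def)

lemma orthonormal_set_nonzero: "orthonormal_set B \<Longrightarrow> 0 \<notin> B"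
  using orthonormal_set_norm by fastforce

lemma orthonormal_set_independent: "orthonormal_set B \<Longrightarrow> independent B"
  for B :: "'a::euclidean_space set"
  by (simp add: orthonormal_set_pairwise orthonormal_set_nonzero pairwise_orthogonal_independent)

lemma orthonormal_set_finite: "orthonormal_set B \<Longrightarrow> finite B"
  for B :: "'a::euclidean_space set"
  by (simp add: orthonormal_set_independent independent_imp_finite)

lemma orthonormal_set_Un:
  assumes "orthonormal_set A" "orthonormal_set B" "\<And>a b. a \<in> A \<Longrightarrow> b \<in> B \<Longrightarrow> a \<bullet> b = 0"
  shows "orthonormal_set (A \<union> B)" and "A \<inter> B = {}"
proof -
  have AB: "a \<bullet> b = 0" "b \<bullet> a = 0" if "a \<in> A" "b \<in> B" for a b
    using assms(3)[OF that] by (auto simp: inner_commute)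
  show dis: "A \<inter> B = {}"
    using assms(1) AB(1) unfolding orthonormal_set_def by fastforce
  show "orthonormal_set (A \<union> B)"
    using assms(1,2) dis unfolding orthonormal_set_def by (auto simp: AB)
qed

lemma symmetric_matrix_inner:
  "symmetric_matrix M \<Longrightarrow> x \<bullet> (M *v y) = (M *v x) \<bullet> y"
  unfolding symmetric_matrix_def by (metis dot_lmul_matrix transpose_matrix_vector)

lemma symmetric_matrix_diff: "symmetric_matrix A \<Longrightarrow> symmetric_matrix B \<Longrightarrow> symmetric_matrix (A - B)"
  by (auto simp: symmetric_matrix_def transpose_def vec_eq_iff)

lemma symmetric_matrix_scaleR: "symmetric_matrix A \<Longrightarrow> symmetric_matrix (c *\<^sub>R A)"
  by (auto simp: symmetric_matrix_def transpose_def vec_eq_iff)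

lemma sum_matrix_vector: "(\<Sum>i\<in>S. A i) *v x = (\<Sum>i\<in>S. A i *v x)" for A :: "'i \<Rightarrow> real^'n^'m"
  by (induction S rule: infinite_finite_induct) (auto simp: matrix_vector_mult_add_rdistrib)

text \<open>The polynomial \<open>t \<mapsto> (e + t *\<^sub>R w) \<bullet> f (e + t *\<^sub>R
  w)\<close> is nonnegative and has no constant term, so its linear coefficient
  \<open>2 * (w \<bullet> f e)\<close> must vanish. Nonnegativity on a subspace \<open>W\<close> is
  enough, which lets the lemma act on an invariant subspace below.\<close>

lemma semidefinite_isotropic:
  fixes f :: "'a::real_inner \<Rightarrow> 'a"
  assumes lin: "linear f" and sym: "\<And>x y. x \<bullet> f y = f x \<bullet> y"
    and W: "subspace W" and nn: "\<And>w. w \<in> W \<Longrightarrow> 0 \<le> w \<bullet> f w"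
    and e: "e \<in> W" "e \<bullet> f e = 0" and w: "w \<in> W"
  shows "w \<bullet> f e = 0"
proof -
  let ?b = "w \<bullet> f e"
  have q: "0 \<le> 2 * t * ?b + t\<^sup>2 * (w \<bullet> f w)" for t
  proof -
    have "0 \<le> (e + t *\<^sub>R w) \<bullet> f (e + t *\<^sub>R w)"
      using W e w by (intro nn) (simp add: subspace_add subspace_scale)
    also have "\<dots> = 2 * t * ?b + t\<^sup>2 * (w \<bullet> f w)"
      using e sym[of e w]
      by (simp add: linear_add[OF lin] linear_scale[OF lin] inner_add_left inner_add_right
          power2_eq_square algebra_simps inner_commute)
    finally show ?thesis .
  qed
  \<comment> \<open>Evaluating \<open>q\<close> at \<open>- s\<close> gives 0 \<le> - s^2 (c + 2),
    hence s = 0. The summand 1 keeps the denominator positive when c = 0.\<close>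
  define c s where "c = w \<bullet> f w" and "s = ?b / (c + 1)"
  have c: "0 \<le> c" using nn w by (simp add: c_def)
  then have b: "?b = s * (c + 1)" by (simp add: s_def)
  have "0 \<le> 2 * (- s) * ?b + (- s)\<^sup>2 * c" unfolding c_def by (rule q)
  also have "\<dots> = - (s\<^sup>2 * (c + 2))"
    unfolding b by (simp add: algebra_simps power2_eq_square)
  finally have "s = 0" using c by (simp add: mult_le_0_iff)
  then show ?thesis using b by simp
qed

lemma psd_isotropic:
  assumes "psd M" "v \<bullet> (M *v v) = 0"
  shows "M *v v = 0"
proof -
  have sym: "x \<bullet> (M *v y) = (M *v x) \<bullet> y" for x y
    using assms(1) by (intro symmetric_matrix_inner) (simp add: psd_def)
  have nn: "0 \<le> w \<bullet> (M *v w)" for w using assms(1) by (simp add: psd_def)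
  have "(M *v v) \<bullet> (M *v v) = 0"
    by (rule semidefinite_isotropic[OF matrix_vector_mul_linear sym subspace_UNIV nn UNIV_I assms(2) UNIV_I])
  then show ?thesis by simp
qed

text \<open>Let \<open>e\<close> maximise the Rayleigh quotient on the unit sphere of
  \<open>W\<close>, with maximum \<open>\<mu>\<close>. Then \<open>\<mu> I - M\<close> is
  semidefinite on \<open>W\<close> and isotropic at \<open>e\<close>. Its value at \<open>e\<close>
  lies in \<open>W\<close> by invariance, so it is orthogonal to itself and vanishes.\<close>

lemma symmetric_eigenvector_exists:
  assumes sym: "symmetric_matrix M" and W: "subspace W"
    and inv: "\<And>w. w \<in> W \<Longrightarrow> M *v w \<in> W" and ne: "W \<noteq> {0}"
  obtains e where "e \<in> W" "norm e = 1" "M *v e = (e \<bullet> (M *v e)) *\<^sub>R e"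
proof -
  let ?S = "sphere 0 1 \<inter> W"
  obtain w where w: "w \<in> W" "w \<noteq> 0" using ne W subspace_0 by blast
  then have "(1 / norm w) *\<^sub>R w \<in> ?S" using W by (simp add: subspace_scale)
  then have ne: "?S \<noteq> {}" by blast
  have comp: "compact ?S" using W by (simp add: closed_subspace compact_Int_closed)
  have "continuous_on ?S (\<lambda>y. y \<bullet> (M *v y))"
    by (intro continuous_on_inner continuous_on_id linear_continuous_on
        matrix_vector_mul_bounded_linear)
  from continuous_attains_sup[OF comp ne this]
  obtain e where e: "e \<in> ?S" "\<And>y. y \<in> ?S \<Longrightarrow> y \<bullet> (M *v y) \<le> e \<bullet> (M *v e)" by blast
  define \<mu> where "\<mu> = e \<bullet> (M *v e)"
  define f where "f = (\<lambda>v. \<mu> *\<^sub>R v - M *v v)"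
  have lin: "linear f"
    unfolding f_def by (intro linear_compose_sub linear_scaleR matrix_vector_mul_linear)
  have eW: "e \<in> W" and ee: "e \<bullet> e = 1" and ne1: "norm e = 1"
    using e(1) by (auto simp: norm_eq_1)
  have nn: "0 \<le> w \<bullet> f w" if "w \<in> W" for w
  proof (cases "w = 0")
    case False
    then have "(1 / norm w) *\<^sub>R w \<in> ?S" using W that by (simp add: subspace_scale)
    from e(2)[OF this] have "(w \<bullet> (M *v w)) / (norm w)\<^sup>2 \<le> \<mu>"
      by (simp add: \<mu>_def matrix_vector_mult_scaleR power2_eq_square divide_inverse mult_ac)
    then show ?thesis
      using False by (simp add: f_def inner_diff_right field_simps power2_norm_eq_inner)
  qed (simp add: f_def)
  have feW: "f e \<in> W"
    unfolding f_def using W eW inv by (simp add: subspace_diff subspace_scale)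
  have symf: "x \<bullet> f y = f x \<bullet> y" for x y
    by (simp add: f_def inner_diff_right inner_diff_left symmetric_matrix_inner[OF sym])
  have ef: "e \<bullet> f e = 0" by (simp add: f_def inner_diff_right ee \<mu>_def)
  have "f e \<bullet> f e = 0"
    by (rule semidefinite_isotropic[OF lin symf W nn eW ef feW])
  then show ?thesis
    using that[OF eW ne1] by (simp add: f_def \<mu>_def)
qed

text \<open>Induction on the dimension: split off a unit eigenvector \<open>e\<close>; by symmetry
  its orthogonal complement within \<open>W\<close> is again invariant. A general \<open>W\<close>
  is allowed because the result is later used on the orthogonal complement of given
  eigenvectors.\<close>

lemma symmetric_eigenbasis:
  assumes sym: "symmetric_matrix M" and "subspace W" and "\<And>w. w \<in> W \<Longrightarrow> M *v w \<in> W"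
  shows "\<exists>F. orthonormal_set F \<and> span F = W \<and> (\<forall>v\<in>F. M *v v = (v \<bullet> (M *v v)) *\<^sub>R v)"
  using assms(2,3)
proof (induction "dim W" arbitrary: W rule: less_induct)
  case less
  show ?case
  proof (cases "W = {0}")
    case True
    then show ?thesis by (intro exI[of _ "{}"]) (simp add: orthonormal_set_def)
  next
    case False
    obtain e where e: "e \<in> W" "norm e = 1" "M *v e = (e \<bullet> (M *v e)) *\<^sub>R e"
      using symmetric_eigenvector_exists[OF sym less.prems False] by metis
    define W' where "W' = {w \<in> W. w \<bullet> e = 0}"
    have ee: "e \<bullet> e = 1" using e(2) by (simp add: norm_eq_1)
    have sub: "subspace W'"
      using less.prems(1) unfolding W'_def subspace_def by (auto simp: inner_add_left)
    have inv: "M *v w \<in> W'" if "w \<in> W'" for w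
    proof -
      have "(M *v w) \<bullet> e = w \<bullet> (M *v e)" using symmetric_matrix_inner[OF sym] by simp
      also have "\<dots> = 0" using that by (subst e(3)) (simp add: W'_def)
      finally show ?thesis using that less.prems(2) by (simp add: W'_def)
    qed
    have "e \<notin> W'" "W' \<subseteq> W" using ee by (auto simp: W'_def)
    then have "W' \<subset> W" using e(1) by blast
    then have "dim W' < dim W"
      using sub less.prems(1) by (intro dim_psubset) (metis span_eq_iff)
    from less.hyps[OF this sub inv] obtain F where F: "orthonormal_set F" "span F = W'"
      "\<forall>v\<in>F. M *v v = (v \<bullet> (M *v v)) *\<^sub>R v" by blast
    have FW: "v \<bullet> e = 0" "v \<in> W" if "v \<in> F" for v
      using that F(2) span_base[of v F] by (auto simp: W'_def)
    have "orthonormal_set (insert e F)"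
      using F(1) FW ee unfolding orthonormal_set_def by (auto simp: inner_commute)
    moreover have "span (insert e F) = W"
    proof
      show "span (insert e F) \<subseteq> W" using e(1) FW less.prems(1) by (intro span_minimal) auto
      show "W \<subseteq> span (insert e F)"
      proof
        fix w assume w: "w \<in> W"
        have "w - (w \<bullet> e) *\<^sub>R e \<in> W'"
          using w e(1) less.prems(1) ee
          by (simp add: W'_def subspace_diff subspace_scale inner_diff_left)
        then show "w \<in> span (insert e F)" using F(2) by (auto simp: span_insert)
      qed
    qed
    ultimately show ?thesis using F(3) e(3) by blast
  qed
qed

section \<open>Rank-one matrices and complementary pairs of semidefinite matrices\<close>

text \<open>This is v v^T; the Frobenius product with it evaluates quadratic forms.\<close>

definition outer :: "real^'m \<Rightarrow> real^'m^'m" where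
  "outer v = (\<chi> i j. v $ i * v $ j)"

lemma outer_mult_vec: "outer v *v x = (v \<bullet> x) *\<^sub>R v"
  by (simp add: outer_def matrix_vector_mult_def vec_eq_iff inner_vec_def sum_distrib_left
      sum_distrib_right mult_ac)

lemma inner_outer: "M \<bullet> outer v = v \<bullet> (M *v v)"
  by (simp add: outer_def matrix_vector_mult_def inner_vec_def sum_distrib_left mult_ac)

lemma psd_sum_outer:
  assumes "\<And>i. i \<in> S \<Longrightarrow> 0 \<le> c i"
  shows "psd (\<Sum>i\<in>S. c i *\<^sub>R outer (e i))"
proof -
  have "symmetric_matrix (\<Sum>i\<in>S. c i *\<^sub>R outer (e i))"
    by (simp add: symmetric_matrix_def transpose_def vec_eq_iff outer_def mult.commute)
  moreover have "0 \<le> v \<bullet> ((\<Sum>i\<in>S. c i *\<^sub>R outer (e i)) *v v)" for v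
    using assms by (auto simp: sum_matrix_vector scaleR_matrix_vector_assoc[symmetric] outer_mult_vec inner_sum_right
        inner_commute mult.assoc intro!: sum_nonneg)
  ultimately show ?thesis by (simp add: psd_def)
qed

lemma spectral_decomposition:
  fixes Y :: "real^'m^'m"
  assumes B: "orthonormal_set B" "span B = UNIV" and Y: "\<And>b. b \<in> B \<Longrightarrow> Y *v b = c b *\<^sub>R b"
  shows "Y = (\<Sum>b\<in>B. c b *\<^sub>R outer b)"
proof -
  have "Y *v x = (\<Sum>b\<in>B. c b *\<^sub>R outer b) *v x" for x
  proof (rule linear_eq_on[where f="(*v) Y" and B=B and x=x])
    show "x \<in> span B" using B by simp
    fix b assume b: "b \<in> B"
    have "(\<Sum>a\<in>B. c a *\<^sub>R outer a) *v b = (\<Sum>a\<in>B. if a = b then c b *\<^sub>R b else 0)"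
      unfolding sum_matrix_vector
      using B(1) b by (intro sum.cong) (auto simp: scaleR_matrix_vector_assoc[symmetric] outer_mult_vec orthonormal_set_def)
    then show "Y *v b = (\<Sum>a\<in>B. c a *\<^sub>R outer a) *v b"
      using b Y orthonormal_set_finite[OF B(1)] by simp
  qed auto
  then show ?thesis by (simp add: matrix_eq)
qed

text \<open>Expanded in an eigenbasis of \<open>Y\<close>, the inner product is a sum of nonnegative
  terms \<open>c b * (b \<bullet> (M *v b))\<close>, so each is zero. Where \<open>c b\<close> is
  nonzero, \<open>M\<close> is isotropic at \<open>b\<close> and thus annihilates it.\<close>

lemma psd_orthogonal_mult:
  fixes M Y :: "real^'m^'m"
  assumes M: "psd M" and Y: "psd Y" and orth: "M \<bullet> Y = 0"
  shows "M *v (Y *v v) = 0"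
proof -
  have symY: "symmetric_matrix Y" using Y by (simp add: psd_def)
  obtain B where B: "orthonormal_set B" "span B = UNIV" "\<forall>b\<in>B. Y *v b = (b \<bullet> (Y *v b)) *\<^sub>R b"
    using symmetric_eigenbasis[OF symY, of UNIV] by auto
  define c where "c b = b \<bullet> (Y *v b)" for b
  have Ye: "Y = (\<Sum>b\<in>B. c b *\<^sub>R outer b)"
    by (rule spectral_decomposition[OF B(1,2)]) (use B(3) c_def in auto)
  have fin: "finite B" by (rule orthonormal_set_finite[OF B(1)])
  have c0: "0 \<le> c b" for b using Y by (simp add: c_def psd_def)
  have "(\<Sum>b\<in>B. c b * (b \<bullet> (M *v b))) = 0"
    using orth by (subst (asm) Ye) (simp add: inner_sum_right inner_outer)
  then have z: "\<forall>b\<in>B. c b * (b \<bullet> (M *v b)) = 0"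
    using fin c0 M by (subst (asm) sum_nonneg_eq_0_iff) (auto simp: psd_def)
  have "c b *\<^sub>R (b \<bullet> v) *\<^sub>R (M *v b) = 0" if "b \<in> B" for b
    using z that psd_isotropic[OF M, of b] by auto
  then have "(\<Sum>b\<in>B. c b *\<^sub>R (b \<bullet> v) *\<^sub>R (M *v b)) = 0"
    by (rule sum.neutral[OF ballI])
  then show ?thesis
    by (subst Ye) (simp add: sum_matrix_vector scaleR_matrix_vector_assoc[symmetric] outer_mult_vec
        linear_sum[OF matrix_vector_mul_linear] matrix_vector_mult_scaleR del: scaleR_scaleR)
qed

text \<open>Since \<open>M\<close> and \<open>Y\<close> annihilate each other's ranges, applying
  \<open>Y\<close> or \<open>M\<close> to the eigenvector equation separates it: - t Y(Ye) = l Ye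
  and M(Me) = l Me. By semidefiniteness, l > 0 forces Ye = 0, and l < 0 forces Me = 0, leaving - t
  Ye = l e. For l = 0, Y(Ye) = 0 gives Ye = 0.\<close>

lemma eigenvector_psd_pencil:
  fixes M Y :: "real^'m^'m"
  assumes M: "psd M" and Y: "psd Y" and orth: "M \<bullet> Y = 0" and t: "0 < t"
    and e: "(M - t *\<^sub>R Y) *v e = l *\<^sub>R e"
  shows "Y *v e = (max 0 (- l) / t) *\<^sub>R e"
proof -
  have MY: "M *v (Y *v v) = 0" for v by (rule psd_orthogonal_mult[OF M Y orth])
  have YM: "Y *v (M *v v) = 0" for v
    by (rule psd_orthogonal_mult[OF Y M]) (simp add: inner_commute orth)
  have eq: "M *v e - t *\<^sub>R (Y *v e) = l *\<^sub>R e"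
    using e by (simp add: matrix_vector_mult_diff_rdistrib scaleR_matrix_vector_assoc[symmetric])
  let ?u = "Y *v e" and ?w = "M *v e"
  have "Y *v (M *v e - t *\<^sub>R (Y *v e)) = l *\<^sub>R ?u"
    unfolding eq by (simp add: matrix_vector_mult_scaleR)
  then have u: "- t *\<^sub>R (Y *v ?u) = l *\<^sub>R ?u"
    by (simp add: matrix_vector_mult_diff_distrib matrix_vector_mult_scaleR YM)
  have "M *v (M *v e - t *\<^sub>R (Y *v e)) = l *\<^sub>R ?w"
    unfolding eq by (simp add: matrix_vector_mult_scaleR)
  then have w: "M *v ?w = l *\<^sub>R ?w"
    by (simp add: matrix_vector_mult_diff_distrib matrix_vector_mult_scaleR MY)
  consider "l > 0" | "l = 0" | "l < 0" by linarith
  then show ?thesis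
  proof cases
    case 1
    have "- t * (?u \<bullet> (Y *v ?u)) = l * (?u \<bullet> ?u)"
      using arg_cong[OF u, of "\<lambda>z. ?u \<bullet> z"] by simp
    moreover have "0 \<le> t * (?u \<bullet> (Y *v ?u))" using Y t by (simp add: psd_def)
    ultimately have "l * (?u \<bullet> ?u) \<le> 0" by simp
    then have "?u \<bullet> ?u \<le> 0" using 1 by (simp add: mult_le_0_iff)
    then have "?u = 0" by (metis inner_gt_zero_iff not_less)
    then show ?thesis using 1 by simp
  next
    case 2
    then have "Y *v ?u = 0" using u t by simp
    then have "?u \<bullet> ?u = 0"
      using Y symmetric_matrix_inner[of Y e ?u] by (simp add: psd_def)
    then show ?thesis using 2 by simp
  next
    case 3
    have "?w \<bullet> (M *v ?w) = l * (?w \<bullet> ?w)" using w by simp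
    moreover have "0 \<le> ?w \<bullet> (M *v ?w)" using M by (simp add: psd_def)
    ultimately have "?w \<bullet> ?w \<le> 0" using 3 by (simp add: zero_le_mult_iff)
    then have "?w = 0" by (metis inner_gt_zero_iff not_less)
    then have "l *\<^sub>R e = - (t *\<^sub>R ?u)" using eq by (metis diff_0)
    then have "t *\<^sub>R ?u = - l *\<^sub>R e" by (metis minus_minus scaleR_minus_left)
    then have "(1 / t) *\<^sub>R (t *\<^sub>R ?u) = (1 / t) *\<^sub>R (- l *\<^sub>R e)" by simp
    then show ?thesis using 3 t by simp
  qed
qed

section \<open>Ordered eigenvalues and multipliers\<close>

lemma sum_const_poly: "(\<Sum>k\<in>S. [:a k:]) = [:\<Sum>k\<in>S. a k:]"
  by (induction S rule: infinite_finite_induct) auto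

text \<open>Ties the roots defining \<open>eigval\<close> to an eigenbasis. The constant matrix
  \<open>Q\<close> with the basis vectors as columns satisfies \<open>P ** Q = Q ** D\<close> with
  \<open>D\<close> diagonal, and \<open>det Q\<close> cancels in the integral domain of
  polynomials.\<close>

lemma charpoly_eigenbasis:
  fixes M :: "real^'m^'m"
  assumes B: "orthonormal_set B" "span B = UNIV" and c: "\<And>b. b \<in> B \<Longrightarrow> M *v b = c b *\<^sub>R b"
  shows "charpoly M = (\<Prod>b\<in>B. [:- c b, 1:])"
proof -
  have fin: "finite B" by (rule orthonormal_set_finite[OF B(1)])
  have "card B = CARD('m)"
    using dim_eq_card[OF _ orthonormal_set_independent[OF B(1)], of UNIV] B(2) by simp
  \<comment> \<open>Indexing the basis by \<open>'m\<close> itself makes \<open>Q\<close> a square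
    matrix.\<close>
  then obtain h :: "'m \<Rightarrow> real^'m" where h: "bij_betw h UNIV B"
    using fin by (metis bij_betw_iff_card finite)
  have hB: "h j \<in> B" for j using h by (auto simp: bij_betw_def)
  have hh: "h i \<bullet> h j = (if i = j then 1 else 0)" for i j
    using B(1) hB h unfolding orthonormal_set_def by (metis bij_betw_def inj_eq)
  define P :: "real poly^'m^'m" where
    "P = (\<chi> i j. (if i = j then [:0, 1:] else 0) - [:M $ i $ j:])"
  define Q :: "real poly^'m^'m" where "Q = (\<chi> i j. [:h j $ i:])"
  define D :: "real poly^'m^'m" where "D = (\<chi> i j. if i = j then [:- c (h j), 1:] else 0)"
  have "transpose Q ** Q = mat 1"
    using hh by (auto simp: Q_def transpose_def matrix_matrix_mult_def mat_def vec_eq_iff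
        sum_const_poly inner_vec_def one_pCons)
  then have "det (transpose Q) * det Q = 1" by (metis det_I det_mul)
  then have Q0: "det Q \<noteq> 0" by auto
  have "P ** Q = Q ** D"
  proof -
    have "(\<Sum>k\<in>UNIV. ((if i = k then [:0, 1:] else 0) - [:M $ i $ k:]) * [:h j $ k:])
        = (\<Sum>k\<in>UNIV. [:h k $ i:] * (if k = j then [:- c (h j), 1:] else 0))" for i j
    proof -
      have "(\<Sum>k\<in>UNIV. ((if i = k then [:0, 1:] else 0) - [:M $ i $ k:]) * [:h j $ k:])
        = (\<Sum>k\<in>UNIV. (if i = k then [:0, 1:] * [:h j $ k:] else 0)) - (\<Sum>k\<in>UNIV. [:M $ i $ k * h j $ k:])"
        unfolding sum_subtractf[symmetric] by (intro sum.cong) (auto simp: left_diff_distrib)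
      also have "\<dots> = [:0, 1:] * [:h j $ i:] - [:(M *v h j) $ i:]"
        unfolding sum_const_poly by (simp add: matrix_vector_mult_def)
      also have "\<dots> = [:h j $ i:] * [:- c (h j), 1:]"
        using c[OF hB, of j] by simp
      also have "\<dots> = (\<Sum>k\<in>UNIV. (if k = j then [:h k $ i:] * [:- c (h j), 1:] else 0))"
        by simp
      also have "\<dots> = (\<Sum>k\<in>UNIV. [:h k $ i:] * (if k = j then [:- c (h j), 1:] else 0))"
        by (intro sum.cong) auto
      finally show ?thesis .
    qed
    then show ?thesis
      unfolding P_def Q_def D_def matrix_matrix_mult_def vec_eq_iff by simp
  qed
  then have "det P * det Q = det Q * det D" by (metis det_mul)
  then have "det P = det D" using Q0 by simp
  also have "\<dots> = (\<Prod>j\<in>UNIV. [:- c (h j), 1:])"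
    by (subst det_diagonal) (auto simp: D_def)
  also have "\<dots> = (\<Prod>b\<in>B. [:- c b, 1:])" by (rule prod.reindex_bij_betw[OF h])
  finally show ?thesis by (simp add: charpoly_def P_def)
qed

lemma proots_charpoly_eigenbasis:
  fixes M :: "real^'m^'m"
  assumes B: "orthonormal_set B" "span B = UNIV" and c: "\<And>b. b \<in> B \<Longrightarrow> M *v b = c b *\<^sub>R b"
  shows "proots (charpoly M) = image_mset c (mset_set B)"
proof -
  have "(\<Sum>b\<in>B. {#c b#}) = image_mset c (mset_set B)"
    using orthonormal_set_finite[OF B(1)] by (induction B rule: finite_induct) auto
  then show ?thesis
    by (subst charpoly_eigenbasis[OF assms]) (auto simp: proots_prod)
qed

lemma span_orthogonal_complement:
  assumes A: "orthonormal_set A" and F: "span F = {w. \<forall>a\<in>A. w \<bullet> a = 0}"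
  shows "span (A \<union> F) = (UNIV :: 'a::euclidean_space set)"
proof -
  have fin: "finite A" by (rule orthonormal_set_finite[OF A])
  have "x \<in> span (A \<union> F)" for x :: 'a
  proof -
    let ?p = "\<Sum>a\<in>A. (x \<bullet> a) *\<^sub>R a"
    have "(\<Sum>b\<in>A. (x \<bullet> b) * (b \<bullet> a)) = x \<bullet> a" if "a \<in> A" for a
    proof -
      have "(\<Sum>b\<in>A. (x \<bullet> b) * (b \<bullet> a)) = (\<Sum>b\<in>A. if b = a then x \<bullet> a else 0)"
        using A that by (intro sum.cong) (auto simp: orthonormal_set_def)
      then show ?thesis using fin that by simp
    qed
    then have "x - ?p \<in> span F"
      unfolding F by (simp add: inner_diff_left inner_sum_left)
    then have "x - ?p \<in> span (A \<union> F)" using span_mono[of F "A \<union> F"] by auto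
    moreover have "?p \<in> span (A \<union> F)"
      by (intro span_sum span_scale span_base) auto
    ultimately show ?thesis by (metis diff_add_cancel span_add)
  qed
  then show ?thesis by blast
qed

lemma quadratic_form_span_nonpos:
  fixes M :: "real^'m^'m"
  assumes T: "orthonormal_set T" and c: "\<And>b. b \<in> T \<Longrightarrow> M *v b = c b *\<^sub>R b"
    and neg: "\<And>b. b \<in> T \<Longrightarrow> c b \<le> 0" and u: "u \<in> span T"
  shows "u \<bullet> (M *v u) \<le> 0"
proof -
  have eq: "(\<Sum>b\<in>T. (u \<bullet> b) *\<^sub>R b) = u"
    by (rule orthonormal_basis_expand[OF orthonormal_set_pairwise[OF T] orthonormal_set_norm[OF T] u
          orthonormal_set_finite[OF T]])
  have "M *v u = (\<Sum>b\<in>T. (u \<bullet> b) *\<^sub>R c b *\<^sub>R b)"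
    by (subst eq[symmetric])
       (simp add: linear_sum[OF matrix_vector_mul_linear] matrix_vector_mult_scaleR c del: scaleR_scaleR)
  then have "u \<bullet> (M *v u) = (\<Sum>b\<in>T. (u \<bullet> b)\<^sup>2 * c b)"
    by (simp add: inner_sum_right power2_eq_square mult_ac)
  also have "\<dots> \<le> 0" using neg by (intro sum_nonpos) (simp add: mult_nonneg_nonpos)
  finally show ?thesis .
qed

text \<open>The columns of \<open>E\<close> use up the last m - r entries of the ordered eigenvalue
  list, so an eigenbasis \<open>F\<close> of their orthogonal complement carries the first r. If one
  of these were negative, all columns of \<open>E\<close> would have negative eigenvalues too, and
  the form would be nonpositive on a space of dimension m - r + 1, which must meet \<open>V\<close>
  nontrivially.\<close>

lemma eigvec_matrices_complement:
  fixes M :: "real^'m^'m"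
  assumes sym: "symmetric_matrix M" and r: "r \<le> CARD('m)" and E: "E \<in> eigvec_matrices r M"
    and V: "subspace V" "r \<le> dim V" and pos: "\<And>v. v \<in> V \<Longrightarrow> v \<noteq> 0 \<Longrightarrow> 0 < v \<bullet> (M *v v)"
  obtains F where "orthonormal_set (E ` {1..CARD('m) - r} \<union> F)"
    "span (E ` {1..CARD('m) - r} \<union> F) = UNIV" "E ` {1..CARD('m) - r} \<inter> F = {}"
    "inj_on E {1..CARD('m) - r}" "\<And>v. v \<in> F \<Longrightarrow> \<exists>l\<ge>0. M *v v = l *\<^sub>R v"
proof -
  define S where "S = {1..CARD('m) - r}"
  define A where "A = E ` S"
  define L where "L = rev (sorted_list_of_multiset (proots (charpoly M)))"
  have ev: "eigval i M = L ! (i - 1)" for i by (simp add: eigval_def L_def)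
  have EE: "E i \<bullet> E j = (if i = j then 1 else 0)" if "i \<in> S" "j \<in> S" for i j
    using E that by (auto simp: eigvec_matrices_def S_def)
  have ME: "M *v E i = L ! (r + i - 1) *\<^sub>R E i" if "i \<in> S" for i
    using E that by (auto simp: eigvec_matrices_def S_def ev)
  have inj: "inj_on E S" using EE by (intro inj_onI) (metis zero_neq_one)
  have oA: "orthonormal_set A"
    using EE inj by (auto simp: orthonormal_set_def A_def inj_on_eq_iff)
  define W where "W = {w. \<forall>a\<in>A. w \<bullet> a = 0}"
  have sW: "subspace W" by (auto simp: W_def subspace_def inner_add_left)
  have iW: "M *v w \<in> W" if "w \<in> W" for w
    using that ME by (auto simp: W_def A_def symmetric_matrix_inner[OF sym, symmetric])
  obtain F where F: "orthonormal_set F" "span F = W"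
    and Fe: "\<And>v. v \<in> F \<Longrightarrow> M *v v = (v \<bullet> (M *v v)) *\<^sub>R v"
    using symmetric_eigenbasis[OF sym sW iW] by blast
  have AF: "a \<bullet> b = 0" if "a \<in> A" "b \<in> F" for a b
    using that span_base[of b F] F(2) by (auto simp: W_def inner_commute)
  note oB = orthonormal_set_Un[OF oA F(1) AF]
  have sB: "span (A \<union> F) = UNIV"
    by (rule span_orthogonal_complement[OF oA]) (simp add: F(2) W_def)
  have fin: "finite A" "finite F" using oA F(1) orthonormal_set_finite by auto
  have cB: "card (A \<union> F) = CARD('m)"
    using dim_eq_card[OF _ orthonormal_set_independent[OF oB(1)], of UNIV] sB by simp
  have cA: "card A = CARD('m) - r" using inj by (simp add: A_def card_image S_def)
  define c where "c b = b \<bullet> (M *v b)" for b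
  have cE: "c (E i) = L ! (r + i - 1)" if "i \<in> S" for i
    using that ME EE by (simp add: c_def)
  have Mc: "M *v b = c b *\<^sub>R b" if "b \<in> A \<union> F" for b
    using that Fe ME cE by (auto simp: A_def c_def)
  have mL: "mset L = image_mset c (mset_set A) + image_mset c (mset_set F)"
    using proots_charpoly_eigenbasis[OF oB(1) sB Mc] fin oB(2)
    by (simp add: L_def mset_set_Union)
  have lenL: "length L = CARD('m)"
    using arg_cong[OF mL, of size] fin cB oB(2) by (simp add: card_Un_disjoint)
  \<comment> \<open>\<open>eigval\<close> counts from 1 and lists from 0, so the columns 1, ..., m -
    r correspond exactly to the positions of \<open>drop r L\<close>.\<close>
  have "image_mset c (mset_set A) = image_mset (\<lambda>i. L ! (r + i - 1)) (mset_set S)"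
    using inj cE unfolding A_def
    by (subst image_mset_mset_set[symmetric]) (auto simp: multiset.map_comp S_def intro!: image_mset_cong)
  also have "\<dots> = mset (map (\<lambda>i. L ! (r + i - 1)) [1..<CARD('m) - r + 1])"
    by (simp add: S_def atLeastLessThanSuc_atLeastAtMost del: upt_Suc)
  also have "map (\<lambda>i. L ! (r + i - 1)) [1..<CARD('m) - r + 1] = drop r L"
    using lenL r by (intro nth_equalityI) (auto simp del: upt_Suc)
  finally have mA: "image_mset c (mset_set A) = mset (drop r L)" .
  moreover have "mset L = mset (take r L) + mset (drop r L)"
    by (metis append_take_drop_id mset_append)
  \<comment> \<open>Cancelling the multiset of the columns from the whole spectrum leaves the r
    largest eigenvalues for \<open>F\<close>.\<close>
  ultimately have mF: "image_mset c (mset_set F) = mset (take r L)" using mL by simp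
  have sorted: "sorted_wrt (\<ge>) L"
    unfolding L_def sorted_wrt_rev by simp
  have le: "y \<le> x" if "x \<in> set (take r L)" "y \<in> set (drop r L)" for x y
    using sorted that by (metis append_take_drop_id sorted_wrt_append)
  have "0 \<le> c v" if v: "v \<in> F" for v
  proof (rule ccontr)
    assume neg: "\<not> 0 \<le> c v"
    have "c v \<in># image_mset c (mset_set F)" using v fin by simp
    then have cv: "c v \<in> set (take r L)" unfolding mF by simp
    have cA0: "c a \<le> 0" if "a \<in> A" for a
    proof -
      have "c a \<in># image_mset c (mset_set A)" using that fin by simp
      then have "c a \<le> c v" using le[OF cv] unfolding mA by simp
      then show ?thesis using neg by simp
    qed
    let ?T = "insert v A"
    have TB: "?T \<subseteq> A \<union> F" using v by auto
    have oT: "orthonormal_set ?T" using oB(1) TB unfolding orthonormal_set_def by blast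
    have "dim (span ?T) = card ?T"
      by (simp add: dim_eq_card_independent orthonormal_set_independent oT)
    also have "\<dots> = CARD('m) - r + 1" using v oB(2) fin cA by (auto simp: card_insert_if)
    finally have dT: "dim (span ?T) = CARD('m) - r + 1" .
    \<comment> \<open>The two dimensions add up to at least r + (m - r + 1) > m, so the intersection
      is nontrivial.\<close>
    have "dim {x + y |x y. x \<in> V \<and> y \<in> span ?T} + dim (V \<inter> span ?T) = dim V + dim (span ?T)"
      by (rule dim_sums_Int) (auto simp: V)
    moreover have "dim {x + y |x y. x \<in> V \<and> y \<in> span ?T} \<le> CARD('m)"
      using dim_subset_UNIV[of "{x + y |x y. x \<in> V \<and> y \<in> span ?T}"] by simp
    ultimately have "dim (V \<inter> span ?T) \<noteq> 0" using dT V(2) r by linarith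
    then obtain u where u: "u \<in> V" "u \<in> span ?T" "u \<noteq> 0" by (auto simp: dim_eq_0)
    have "u \<bullet> (M *v u) \<le> 0"
      by (rule quadratic_form_span_nonpos[OF oT Mc _ u(2)]) (use TB neg cA0 in auto)
    then show False using pos[OF u(1,3)] by simp
  qed
  then show ?thesis
    using that[of F] oB sB inj Mc by (force simp: A_def S_def)
qed

text \<open>Complete the columns of \<open>E\<close> to an eigenbasis of M - tY. The added vectors
  have nonnegative eigenvalues, so \<open>Y\<close> annihilates them, and the spectral decomposition
  of \<open>Y\<close> involves only the columns of \<open>E\<close>.\<close>

lemma multiplier_decomposition:
  fixes M Y :: "real^'m^'m"
  assumes M: "psd M" and Y: "psd Y" and orth: "M \<bullet> Y = 0" and t: "0 < t"
    and r: "r \<le> CARD('m)" and E: "E \<in> eigvec_matrices r (M - t *\<^sub>R Y)"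
    and V: "subspace V" "r \<le> dim V"
    and pos: "\<And>v. v \<in> V \<Longrightarrow> v \<noteq> 0 \<Longrightarrow> 0 < v \<bullet> ((M - t *\<^sub>R Y) *v v)"
  shows "Y = (\<Sum>i\<in>{1..CARD('m) - r}. (max 0 (- eigval (r + i) (M - t *\<^sub>R Y)) / t) *\<^sub>R outer (E i))"
proof -
  define N where "N = M - t *\<^sub>R Y"
  define S where "S = {1..CARD('m) - r}"
  have sym: "symmetric_matrix N"
    using M Y by (auto simp: N_def psd_def intro: symmetric_matrix_diff symmetric_matrix_scaleR)
  obtain F where F: "orthonormal_set (E ` S \<union> F)" "span (E ` S \<union> F) = UNIV" "E ` S \<inter> F = {}"
    "inj_on E S" "\<And>v. v \<in> F \<Longrightarrow> \<exists>l\<ge>0. N *v v = l *\<^sub>R v"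
    using eigvec_matrices_complement[OF sym r E[folded N_def] V pos[folded N_def]]
    unfolding S_def by metis
  have fin: "finite (E ` S)" "finite F" using orthonormal_set_finite[OF F(1)] by auto
  define a where "a i = max 0 (- eigval (r + i) N) / t" for i
  define c where "c b = b \<bullet> (Y *v b)" for b
  have YE: "Y *v E i = a i *\<^sub>R E i" "c (E i) = a i" if "i \<in> S" for i
  proof -
    have "N *v E i = eigval (r + i) N *\<^sub>R E i" "E i \<bullet> E i = 1"
      using E that by (auto simp: eigvec_matrices_def N_def S_def)
    then show "Y *v E i = a i *\<^sub>R E i" "c (E i) = a i"
      using eigenvector_psd_pencil[OF M Y orth t, of "E i" "eigval (r + i) N"]
      by (auto simp: N_def a_def c_def)
  qed
  have YF: "Y *v v = 0" if v: "v \<in> F" for v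
  proof -
    obtain l where "l \<ge> 0" "N *v v = l *\<^sub>R v" using F(5)[OF v] by blast
    then show ?thesis
      using eigenvector_psd_pencil[OF M Y orth t, of v l] by (simp add: N_def)
  qed
  have "Y = (\<Sum>b\<in>E ` S \<union> F. c b *\<^sub>R outer b)"
    by (rule spectral_decomposition[OF F(1,2)]) (use YE YF c_def in auto)
  also have "\<dots> = (\<Sum>b\<in>E ` S. c b *\<^sub>R outer b) + (\<Sum>b\<in>F. c b *\<^sub>R outer b)"
    by (rule sum.union_disjoint[OF fin F(3)])
  also have "(\<Sum>b\<in>F. c b *\<^sub>R outer b) = 0"
    by (rule sum.neutral) (simp add: c_def YF)
  also have "(\<Sum>b\<in>E ` S. c b *\<^sub>R outer b) = (\<Sum>i\<in>S. a i *\<^sub>R outer (E i))"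
    using F(4) YE(2) by (simp add: sum.reindex)
  finally show ?thesis by (simp add: a_def S_def N_def)
qed

text \<open>Supplies the space \<open>V\<close> of dimension \<open>rank H\<close> for all matrices
  near \<open>H\<close>. As \<open>H\<close> is symmetric, its range meets its kernel only in 0, so
  the form is positive there, and compactness gives a margin \<open>\<epsilon>\<close> on unit
  vectors. Perturbing by \<open>N - H\<close> costs at most its norm, because w w^T has Frobenius
  norm 1.\<close>

lemma psd_definite_on_range:
  assumes H: "psd H"
  obtains \<epsilon> where "0 < \<epsilon>"
    "\<And>N v. norm (N - H) < \<epsilon> \<Longrightarrow> v \<in> range ((*v) H) \<Longrightarrow> v \<noteq> 0 \<Longrightarrow> 0 < v \<bullet> (N *v v)"
proof -
  let ?V = "range ((*v) H)"
  let ?S = "sphere 0 1 \<inter> ?V"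
  have V: "subspace ?V" by (intro linear_subspace_image) auto
  have sym: "symmetric_matrix H" and nn: "0 \<le> v \<bullet> (H *v v)" for v
    using H by (auto simp: psd_def)
  have pos: "0 < v \<bullet> (H *v v)" if v: "v \<in> ?V" "v \<noteq> 0" for v
  proof -
    obtain x where x: "v = H *v x" using v by blast
    have "v \<bullet> (H *v v) \<noteq> 0"
    proof
      assume "v \<bullet> (H *v v) = 0"
      then have "H *v v = 0" by (rule psd_isotropic[OF H])
      then have "v \<bullet> v = 0" using symmetric_matrix_inner[OF sym, of x v] x by simp
      then show False using v by simp
    qed
    then show ?thesis using nn[of v] by linarith
  qed
  have comp: "compact ?S" using V by (simp add: closed_subspace compact_Int_closed)
  have "\<exists>\<epsilon>>0. \<forall>v\<in>?S. \<epsilon> \<le> v \<bullet> (H *v v)"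
  proof (cases "?S = {}")
    \<comment> \<open>The sphere is empty when \<open>H\<close> is zero; any positive margin then
      works.\<close>
    case True
    show ?thesis unfolding True using zero_less_one by blast
  next
    case False
    have "continuous_on ?S (\<lambda>y. y \<bullet> (H *v y))"
      by (intro continuous_on_inner continuous_on_id linear_continuous_on
          matrix_vector_mul_bounded_linear)
    from continuous_attains_inf[OF comp False this]
    obtain e where "e \<in> ?S" "\<And>y. y \<in> ?S \<Longrightarrow> e \<bullet> (H *v e) \<le> y \<bullet> (H *v y)" by blast
    moreover from this(1) have "e \<in> ?V" "e \<noteq> 0" by auto
    ultimately show ?thesis using pos[of e] by blast
  qed
  then obtain \<epsilon> where \<epsilon>: "0 < \<epsilon>" "\<And>v. v \<in> ?S \<Longrightarrow> \<epsilon> \<le> v \<bullet> (H *v v)" by blast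
  have "0 < v \<bullet> (N *v v)" if N: "norm (N - H) < \<epsilon>" and v: "v \<in> ?V" "v \<noteq> 0" for N v
  proof -
    define w where "w = (1 / norm v) *\<^sub>R v"
    have w: "w \<in> ?S" "v = norm v *\<^sub>R w" using v V by (auto simp: w_def subspace_scale)
    then have "w \<bullet> w = 1" by (simp add: norm_eq_1)
    then have "norm (outer w) = 1"
      by (simp add: norm_eq_1 inner_outer outer_mult_vec)
    then have "\<bar>w \<bullet> ((N - H) *v w)\<bar> \<le> norm (N - H)"
      using Cauchy_Schwarz_ineq2[of "N - H" "outer w"] by (simp add: inner_outer)
    then have "0 < w \<bullet> (N *v w)"
      using N \<epsilon>(2)[OF w(1)] by (simp add: matrix_vector_mult_diff_rdistrib inner_diff_right)
    moreover have "v \<bullet> (N *v v) = (norm v)\<^sup>2 * (w \<bullet> (N *v w))"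
      by (subst (1 2) w(2)) (simp add: matrix_vector_mult_scaleR power2_eq_square)
    ultimately show ?thesis using v by simp
  qed
  then show ?thesis using that \<epsilon>(1) by blast
qed

section \<open>Limits of conic combinations\<close>

text \<open>Subtract from the coefficients a multiple of a linear relation until the first of them
  reaches zero; that index is dropped and the induction continues on a smaller set.\<close>

lemma conic_caratheodory:
  fixes z :: "'i \<Rightarrow> 'a::real_vector"
  assumes "finite S" "\<And>i. i \<in> S \<Longrightarrow> 0 \<le> \<alpha> i"
  shows "\<exists>J \<beta>. J \<subseteq> S \<and> (\<forall>i\<in>J. 0 \<le> \<beta> i) \<and> \<not> lin_dep J z \<and>
    (\<Sum>i\<in>J. \<beta> i *\<^sub>R z i) = (\<Sum>i\<in>S. \<alpha> i *\<^sub>R z i)"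
  using assms
proof (induction S arbitrary: \<alpha> rule: finite_psubset_induct)
  case (psubset S)
  show ?case
  proof (cases "lin_dep S z")
    case False
    then show ?thesis using psubset.prems by blast
  next
    case True
    then obtain \<gamma>0 i0 where g0: "i0 \<in> S" "\<gamma>0 i0 \<noteq> 0" "(\<Sum>i\<in>S. \<gamma>0 i *\<^sub>R z i) = 0"
      unfolding lin_dep_def by blast
    \<comment> \<open>The sign makes the coefficient at \<open>i0\<close> positive, so the minimum
      ratio below ranges over a nonempty set.\<close>
    define \<gamma> where "\<gamma> i = sgn (\<gamma>0 i0) * \<gamma>0 i" for i
    have g: "0 < \<gamma> i0" using g0 by (simp add: \<gamma>_def sgn_mult_self_eq abs_sgn[symmetric] mult.commute)
    have gs: "(\<Sum>i\<in>S. \<gamma> i *\<^sub>R z i) = 0"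
      using g0(3) by (simp add: \<gamma>_def flip: scaleR_scaleR scaleR_sum_right)
    let ?P = "{i\<in>S. 0 < \<gamma> i}"
    \<comment> \<open>The minimal ratio is the largest step that keeps all coefficients nonnegative,
      and it makes the one at \<open>j\<close> vanish.\<close>
    define j where "j = arg_min_on (\<lambda>i. \<alpha> i / \<gamma> i) ?P"
    have P: "finite ?P" "?P \<noteq> {}" using psubset.hyps g g0 by auto
    have j: "j \<in> S" "0 < \<gamma> j" using arg_min_if_finite(1)[OF P, of "\<lambda>i. \<alpha> i / \<gamma> i"] by (auto simp: j_def)
    have jmin: "\<alpha> j / \<gamma> j \<le> \<alpha> i / \<gamma> i" if "i \<in> ?P" for i
      unfolding j_def by (rule arg_min_least[OF P that])
    define \<alpha>' where "\<alpha>' i = \<alpha> i - \<alpha> j / \<gamma> j * \<gamma> i" for i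
    have nn: "0 \<le> \<alpha>' i" if "i \<in> S" for i
    proof (cases "0 < \<gamma> i")
      case True
      then show ?thesis using jmin[of i] that by (simp add: \<alpha>'_def pos_le_divide_eq)
    next
      case False
      then have "\<alpha> j / \<gamma> j * \<gamma> i \<le> 0"
        using j psubset.prems[of j] by (intro mult_nonneg_nonpos) auto
      then show ?thesis using psubset.prems[OF that] by (simp add: \<alpha>'_def)
    qed
    have "(\<Sum>i\<in>S. \<alpha>' i *\<^sub>R z i) = (\<Sum>i\<in>S. \<alpha> i *\<^sub>R z i) - (\<alpha> j / \<gamma> j) *\<^sub>R (\<Sum>i\<in>S. \<gamma> i *\<^sub>R z i)"
      by (simp add: \<alpha>'_def scaleR_diff_left sum_subtractf scaleR_sum_right)
    then have "(\<Sum>i\<in>S. \<alpha>' i *\<^sub>R z i) = (\<Sum>i\<in>S. \<alpha> i *\<^sub>R z i)" by (simp add: gs)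
    moreover have "(\<Sum>i\<in>S. \<alpha>' i *\<^sub>R z i) = (\<Sum>i\<in>S - {j}. \<alpha>' i *\<^sub>R z i)"
      using j psubset.hyps by (subst sum.remove[of S j]) (auto simp: \<alpha>'_def)
    moreover have "S - {j} \<subset> S" using j by blast
    ultimately show ?thesis
      using psubset.IH[of "S - {j}" \<alpha>'] nn by (metis (no_types, lifting) DiffD1 dual_order.trans psubset_imp_subset)
  qed
qed

text \<open>Successive extraction, one index at a time, by compactness of the unit interval.\<close>

lemma bounded_family_subsequence:
  fixes u :: "nat \<Rightarrow> 'i \<Rightarrow> real"
  assumes "finite J" "\<And>n i. i \<in> J \<Longrightarrow> u n i \<in> {0..1}"
  shows "\<exists>\<psi> l. strict_mono (\<psi> :: nat \<Rightarrow> nat) \<and> (\<forall>i\<in>J. (\<lambda>n. u (\<psi> n) i) \<longlonglongrightarrow> l i)"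
  using assms
proof (induction J rule: finite_induct)
  case empty
  then show ?case using strict_mono_id by blast
next
  case (insert j J)
  then obtain \<psi> l where 1: "strict_mono (\<psi> :: nat \<Rightarrow> nat)" "\<forall>i\<in>J. (\<lambda>n. u (\<psi> n) i) \<longlonglongrightarrow> l i"
    by auto
  have "compact {0..1::real}" by simp
  then obtain a \<phi> where 2: "strict_mono (\<phi> :: nat \<Rightarrow> nat)" "((\<lambda>n. u (\<psi> n) j) \<circ> \<phi>) \<longlonglongrightarrow> a"
    using insert.prems unfolding compact_def by (metis insertI1)
  have "(\<lambda>n. u (\<psi> (\<phi> n)) i) \<longlonglongrightarrow> l i" if "i \<in> J" for i
    using LIMSEQ_subseq_LIMSEQ[OF 1(2)[rule_format, OF that] 2(1)] by (simp add: o_def)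
  then have "\<forall>i\<in>insert j J. (\<lambda>n. u ((\<psi> \<circ> \<phi>) n) i) \<longlonglongrightarrow> (l(j := a)) i"
    using 2(2) insert.hyps by (auto simp: o_def)
  then show ?case using strict_mono_o[OF 1(1) 2(1)] by blast
qed

section \<open>Continuous dependence of the derivatives\<close>

lemma tendsto_matrix_vector_mult:
  fixes A :: "'a \<Rightarrow> real^'n^'m"
  assumes "(A \<longlongrightarrow> A0) F" "(v \<longlongrightarrow> v0) F"
  shows "((\<lambda>k. A k *v v k) \<longlongrightarrow> A0 *v v0) F"
proof (rule vec_tendstoI)
  fix i
  show "((\<lambda>k. (A k *v v k) $ i) \<longlongrightarrow> (A0 *v v0) $ i) F"
    unfolding matrix_vector_mult_def vec_lambda_beta
    by (intro tendsto_sum tendsto_mult tendsto_vec_nth assms)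
qed

lemma continuously_differentiable_differentiable:
  "continuously_differentiable F \<Longrightarrow> F differentiable (at x)"
  by (auto simp: continuously_differentiable_def intro: differentiableI)

lemma continuously_differentiable_gradient:
  fixes f :: "real^'n \<Rightarrow> real"
  assumes "continuously_differentiable f"
  obtains g where "\<And>x. GDERIV f x :> g x" "\<And>x. isCont g x"
proof -
  obtain f' :: "real^'n \<Rightarrow> (real^'n) \<Rightarrow>\<^sub>L real" where
    f': "\<And>x. (f has_derivative blinfun_apply (f' x)) (at x)" "continuous_on UNIV f'"
    using assms unfolding continuously_differentiable_def by blast
  \<comment> \<open>The componentwise form yields continuity; the equal form as an adjoint at 1
    yields the gradient property.\<close>
  define g where "g x = (\<chi> l. f' x (axis l 1))" for x
  have g: "g x = adjoint (f' x) 1" for x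
  proof -
    have "adjoint (f' x) 1 $ l = f' x (axis l 1)" for l
      using adjoint_works[OF has_derivative_linear[OF f'(1)], of "axis l 1" x 1]
      by (simp add: inner_axis' inner_real_def)
    then show ?thesis by (simp add: g_def vec_eq_iff)
  qed
  have "GDERIV f x :> g x" for x
    using f'(1)[of x] adjoint_works[OF has_derivative_linear[OF f'(1)], of _ x 1]
    by (simp add: gderiv_def g)
  moreover have "isCont g x" for x
  proof -
    have "isCont f' x" using f'(2) by (simp add: continuous_on_eq_continuous_at)
    then show ?thesis
      unfolding isCont_def g_def
      by (intro vec_tendstoI) (auto intro!: blinfun.tendsto tendsto_const)
  qed
  ultimately show ?thesis using that by blast
qed

lemma continuously_differentiable_partial_deriv:
  fixes G :: "real^'n \<Rightarrow> real^'m^'m"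
  assumes "continuously_differentiable G"
  shows "isCont (partial_deriv G l) x"
proof -
  obtain G' :: "real^'n \<Rightarrow> (real^'n) \<Rightarrow>\<^sub>L (real^'m^'m)" where
    G': "\<And>x. (G has_derivative blinfun_apply (G' x)) (at x)" "continuous_on UNIV G'"
    using assms unfolding continuously_differentiable_def by blast
  have eq: "partial_deriv G l = (\<lambda>x. G' x (axis l 1))"
    using frechet_derivative_at[OF G'(1)] by (auto simp: partial_deriv_def fun_eq_iff)
  have "isCont G' x" using G'(2) by (simp add: continuous_on_eq_continuous_at)
  then show ?thesis
    unfolding eq isCont_def by (auto intro!: blinfun.tendsto tendsto_const)
qed

lemma tendsto_vdiag:
  fixes G :: "real^'n \<Rightarrow> real^'m^'m"
  assumes "continuously_differentiable G" "(x \<longlongrightarrow> x0) F" "((\<lambda>k. E k i) \<longlongrightarrow> E0 i) F"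
  shows "((\<lambda>k. vdiag G (x k) (E k) i) \<longlongrightarrow> vdiag G x0 E0 i) F"
proof (rule vec_tendstoI)
  fix l
  have "((\<lambda>k. partial_deriv G l (x k)) \<longlongrightarrow> partial_deriv G l x0) F"
    by (rule isCont_tendsto_compose[OF continuously_differentiable_partial_deriv[OF assms(1)] assms(2)])
  then show "((\<lambda>k. vdiag G (x k) (E k) i $ l) \<longlongrightarrow> vdiag G x0 E0 i $ l) F"
    unfolding vdiag_def vec_lambda_beta
    by (intro tendsto_inner tendsto_matrix_vector_mult assms)
qed

text \<open>Component l of the adjoint at \<open>Y\<close> is the inner product of the l-th partial
  derivative with \<open>Y\<close>; on e e^T this is a quadratic form at e, which is how
  \<open>vdiag\<close> arises.\<close>

lemma adjoint_derivative_sum_outer: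
  assumes "G differentiable (at x)"
  shows "adjoint (frechet_derivative G (at x)) (\<Sum>i\<in>S. a i *\<^sub>R outer (E i))
    = (\<Sum>i\<in>S. a i *\<^sub>R vdiag G x E i)"
proof -
  let ?D = "frechet_derivative G (at x)"
  have lin: "linear ?D" using assms by (simp add: linear_frechet_derivative)
  have "adjoint ?D Y $ l = partial_deriv G l x \<bullet> Y" for l Y
    using adjoint_works[OF lin, of "axis l 1" Y] by (simp add: inner_axis' partial_deriv_def)
  then show ?thesis
    by (simp add: vec_eq_iff inner_sum_right inner_outer vdiag_def)
qed

text \<open>Lets limits and eventual properties along \<open>I\<close> pass to increasing sequences
  in \<open>I\<close>.\<close>

lemma filterlim_along:
  assumes "strict_mono \<theta>" "\<And>n. \<theta> n \<in> I"
  shows "filterlim \<theta> (along I) sequentially"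
proof -
  have "filterlim \<theta> sequentially sequentially" by (rule filterlim_subseq[OF assms(1)])
  moreover have "\<forall>\<^sub>F n in sequentially. \<theta> n \<in> I" by (intro always_eventually allI assms(2))
  ultimately show ?thesis by (simp only: along_def filterlim_inf filterlim_principal)
qed

theorem theorem4p2:
  fixes f :: "real^'n \<Rightarrow> real" and G :: "real^'n \<Rightarrow> real^'m^'m" and xbar :: "real^'n"
  assumes "continuously_differentiable f"
    and "\<And>x. symmetric_matrix (G x)"
    and "continuously_differentiable G"
    and "xbar \<in> feasible G"
    and "akkt f G xbar"
    and "seq_cpld G xbar"
  shows "kkt f G xbar"
proof -

  \<comment> \<open>AKKT data, perturbed sequence and eigenvector matrices\<close>
  obtain g where g: "\<And>x. GDERIV f x :> g x" "\<And>x. isCont g x"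
    using continuously_differentiable_gradient[OF assms(1)] by blast
  have Gd: "G differentiable (at x)" for x
    by (rule continuously_differentiable_differentiable[OF assms(3)])
  have contG: "isCont G x" for x
    using Gd differentiable_imp_continuous_within by blast
  obtain x Y \<delta> \<Delta> where x: "x \<longlonglongrightarrow> xbar" and Y: "\<And>k. psd (Y k)"
    and \<Delta>: "\<And>k. symmetric_matrix (\<Delta> k)" "\<Delta> \<longlonglongrightarrow> 0"
    and L: "\<And>k. GDERIV (\<lambda>z. lagrangian f G z (Y k)) (x k) :> \<delta> k"
    and M: "\<And>k. psd (G (x k) + \<Delta> k)" and MY': "\<And>k. sym_inner (G (x k) + \<Delta> k) (Y k) = 0"
    and \<delta>: "\<delta> \<longlonglongrightarrow> 0"
    using assms(5) unfolding akkt_def by blast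
  have Ysym: "symmetric_matrix (Y k)" for k using Y by (simp add: psd_def)
  have MY: "(G (x k) + \<Delta> k) \<bullet> Y k = 0" for k
    using MY' by (simp add: sym_inner_eq_inner[OF Ysym])
  \<comment> \<open>The normalisation forces the norm of \<open>t k *\<^sub>R Y k\<close> below 1/(k
    + 1) even if \<open>Y\<close> is unbounded.\<close>
  define t where "t k = inverse (real (Suc k)) / (1 + norm (Y k))" for k
  have den: "0 < 1 + norm (Y k)" for k by (simp add: add_pos_nonneg)
  have t: "0 < t k" for k unfolding t_def using den by (intro divide_pos_pos) auto
  have tY: "(\<lambda>k. t k *\<^sub>R Y k) \<longlonglongrightarrow> 0"
  proof (rule Lim_null_comparison[OF _ LIMSEQ_inverse_real_of_nat])
    have "norm (t k *\<^sub>R Y k) \<le> inverse (real (Suc k))" for k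
    proof -
      have "norm (t k *\<^sub>R Y k) = inverse (real (Suc k)) * (norm (Y k) / (1 + norm (Y k)))"
        using t[of k] by (simp add: t_def)
      also have "\<dots> \<le> inverse (real (Suc k)) * 1"
        using den[of k] by (intro mult_left_mono) (auto simp: divide_le_eq)
      finally show ?thesis by simp
    qed
    then show "\<forall>\<^sub>F k in sequentially. norm (t k *\<^sub>R Y k) \<le> inverse (real (Suc k))" by simp
  qed
  define \<Delta>' where "\<Delta>' = (\<lambda>k. \<Delta> k - t k *\<^sub>R Y k)"
  have \<Delta>': "symmetric_matrix (\<Delta>' k)" "\<Delta>' \<longlonglongrightarrow> 0" for k
    using \<Delta> Ysym tendsto_diff[OF \<Delta>(2) tY]
    by (auto simp: \<Delta>'_def intro: symmetric_matrix_diff symmetric_matrix_scaleR)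
  define H where "H = G xbar"
  define r where "r = rank H"
  define S where "S = {1..CARD('m) - r}"
  define N where "N = (\<lambda>k. G (x k) + \<Delta>' k)"
  have Neq: "N k = G (x k) + \<Delta> k - t k *\<^sub>R Y k" for k by (simp add: N_def \<Delta>'_def)
  have NH: "N \<longlonglongrightarrow> H"
    using tendsto_add[OF isCont_tendsto_compose[OF contG x] \<Delta>'(2)] by (simp add: N_def H_def)
  have H: "psd H" using assms(4) by (simp add: feasible_def H_def)
  have r: "r \<le> CARD('m)" unfolding r_def rank_dim_range using dim_subset_UNIV[of "range ((*v) H)"] by simp
  \<comment> \<open>This merges the two alternatives of seq-CPLD. If r = m there are no columns, so
    zero serves as a dummy, and the empty family is not positively dependent.\<close>
  have "\<exists>I E Ebar. infinite I \<and> (\<forall>k\<in>I. E k \<in> eigvec_matrices r (N k)) \<and>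
      (\<forall>i\<in>S. ((\<lambda>k. E k i) \<longlongrightarrow> Ebar i) (along I)) \<and>
      (\<forall>J\<subseteq>S. pos_lin_dep J (vdiag G xbar Ebar) \<longrightarrow>
         (\<forall>\<^sub>F k in along I. lin_dep J (vdiag G (x k) (E k))))"
  proof (cases "r = CARD('m)")
    case True
    then show ?thesis
      by (intro exI[of _ UNIV] exI[of _ "\<lambda>_ _. 0"] exI[of _ "\<lambda>_. 0"])
         (auto simp: S_def eigvec_matrices_def pos_lin_dep_def)
  next
    case False
    then show ?thesis
      using assms(6) x \<Delta>' unfolding seq_cpld_def Let_def N_def S_def r_def H_def by blast
  qed
  then obtain I E Ebar where I: "infinite I"
    and E': "\<forall>k\<in>I. E k \<in> eigvec_matrices r (N k)"
    and Ebar': "\<forall>i\<in>S. ((\<lambda>k. E k i) \<longlongrightarrow> Ebar i) (along I)"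
    and cpld': "\<forall>J\<subseteq>S. pos_lin_dep J (vdiag G xbar Ebar) \<longrightarrow>
         (\<forall>\<^sub>F k in along I. lin_dep J (vdiag G (x k) (E k)))"
    by (elim exE conjE)
  note E = E'[rule_format] and Ebar = Ebar'[rule_format] and cpld = cpld'[rule_format]

  \<comment> \<open>Reduction of the multipliers to a fixed index set\<close>
  obtain \<epsilon> where \<epsilon>: "0 < \<epsilon>"
    "\<And>N v. norm (N - H) < \<epsilon> \<Longrightarrow> v \<in> range ((*v) H) \<Longrightarrow> v \<noteq> 0 \<Longrightarrow> 0 < v \<bullet> (N *v v)"
    using psd_definite_on_range[OF H] by metis
  obtain K where K: "\<And>k. k \<ge> K \<Longrightarrow> norm (N k - H) < \<epsilon>"
    using LIMSEQ_D[OF NH \<epsilon>(1)] by blast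
  \<comment> \<open>\<open>J\<close> admits coefficients satisfying the AKKT equation over an
    independent family. The strict negativity of the eigenvalues is recorded because it yields
    complementarity in the limit.\<close>
  define R where "R k J \<longleftrightarrow> (\<exists>\<beta>. (\<forall>i\<in>J. 0 \<le> \<beta> i \<and> eigval (r + i) (N k) < 0) \<and>
      \<not> lin_dep J (vdiag G (x k) (E k)) \<and>
      g (x k) - (\<Sum>i\<in>J. \<beta> i *\<^sub>R vdiag G (x k) (E k) i) = \<delta> k)" for k J
  have "\<exists>J\<in>Pow S. R k J" if k: "k \<in> I - {..<K}" for k
  proof -
    define a where "a i = max 0 (- eigval (r + i) (N k)) / t k" for i
    let ?v = "vdiag G (x k) (E k)"
    \<comment> \<open>For k \<ge> K the perturbed matrix is positive definite on the range of
      \<open>H\<close>, which has dimension r and takes the role of \<open>V\<close>.\<close>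
    have dec: "Y k = (\<Sum>i\<in>S. a i *\<^sub>R outer (E k i))"
      unfolding S_def a_def Neq
    proof (rule multiplier_decomposition[OF M Y MY t r])
      show "E k \<in> eigvec_matrices r (G (x k) + \<Delta> k - t k *\<^sub>R Y k)" using E k by (simp add: Neq)
      show "subspace (range ((*v) H))" by (intro linear_subspace_image) auto
      show "r \<le> dim (range ((*v) H))" by (simp add: r_def rank_dim_range)
      show "0 < v \<bullet> ((G (x k) + \<Delta> k - t k *\<^sub>R Y k) *v v)" if "v \<in> range ((*v) H)" "v \<noteq> 0" for v
        using \<epsilon>(2)[OF K that] k by (simp add: Neq)
    qed
    have "\<delta> k = g (x k) - adjoint (frechet_derivative G (at (x k))) (Y k)"
      using L[of k] gderiv_lagrangian[OF g(1) Gd Ysym] by blast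
    also have "\<dots> = g (x k) - (\<Sum>i\<in>S. a i *\<^sub>R ?v i)"
      unfolding dec adjoint_derivative_sum_outer[OF Gd] ..
    finally have "\<delta> k = g (x k) - (\<Sum>i\<in>S. a i *\<^sub>R ?v i)" .
    \<comment> \<open>Indices with nonnegative eigenvalue have \<open>a i = 0\<close>. Discarding
      them before the Caratheodory reduction keeps \<open>J\<close> inside the negative
      part.\<close>
    moreover define T where "T = {i\<in>S. eigval (r + i) (N k) < 0}"
    have "(\<Sum>i\<in>S. a i *\<^sub>R ?v i) = (\<Sum>i\<in>T. a i *\<^sub>R ?v i)"
      by (rule sum.mono_neutral_right) (auto simp: S_def T_def a_def)
    moreover have "finite T" "\<And>i. 0 \<le> a i" using t[of k] by (simp_all add: T_def S_def a_def)
    then obtain J \<beta> where "J \<subseteq> T" "\<forall>i\<in>J. 0 \<le> \<beta> i" "\<not> lin_dep J ?v"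
      "(\<Sum>i\<in>J. \<beta> i *\<^sub>R ?v i) = (\<Sum>i\<in>T. a i *\<^sub>R ?v i)"
      using conic_caratheodory[of T a ?v] by blast
    ultimately show ?thesis unfolding R_def T_def by (intro bexI[of _ J] exI[of _ \<beta>]) auto
  qed
  moreover have "infinite (I - {..<K})" using I by (simp add: Diff_infinite_finite)
  moreover have "finite (Pow S)" by (simp add: S_def)
  \<comment> \<open>There are finitely many candidates \<open>J\<close>, so one of them serves
    infinitely many k.\<close>
  ultimately obtain J where J: "J \<subseteq> S" "infinite {k \<in> I - {..<K}. R k J}"
    using pigeonhole_infinite_rel[of "I - {..<K}" "Pow S" R] by blast
  define \<phi> where "\<phi> = enumerate {k \<in> I - {..<K}. R k J}"
  have \<phi>: "strict_mono \<phi>" unfolding \<phi>_def by (rule strict_mono_enumerate[OF J(2)])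
  have \<phi>R: "\<phi> n \<in> I" "R (\<phi> n) J" for n
    using enumerate_in_set[OF J(2), of n] by (auto simp: \<phi>_def)
  have "\<forall>n. \<exists>\<beta>. (\<forall>i\<in>J. 0 \<le> \<beta> i \<and> eigval (r + i) (N (\<phi> n)) < 0) \<and>
      \<not> lin_dep J (vdiag G (x (\<phi> n)) (E (\<phi> n))) \<and>
      g (x (\<phi> n)) - (\<Sum>i\<in>J. \<beta> i *\<^sub>R vdiag G (x (\<phi> n)) (E (\<phi> n)) i) = \<delta> (\<phi> n)"
    using \<phi>R(2) unfolding R_def by blast
  from choice[OF this] obtain \<beta> where
    \<beta>: "\<And>n i. i \<in> J \<Longrightarrow> 0 \<le> \<beta> n i" "\<And>n i. i \<in> J \<Longrightarrow> eigval (r + i) (N (\<phi> n)) < 0"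
    "\<And>n. \<not> lin_dep J (vdiag G (x (\<phi> n)) (E (\<phi> n)))"
    "\<And>n. g (x (\<phi> n)) - (\<Sum>i\<in>J. \<beta> n i *\<^sub>R vdiag G (x (\<phi> n)) (E (\<phi> n)) i) = \<delta> (\<phi> n)"
    by blast

  \<comment> \<open>Normalised multipliers and their limits\<close>
  have finJ: "finite J" using J(1) finite_subset by (auto simp: S_def)
  define s where "s n = 1 + (\<Sum>i\<in>J. \<beta> n i)" for n
  have s: "1 \<le> s n" for n using \<beta>(1) by (simp add: s_def sum_nonneg)
  \<comment> \<open>Normalising by \<open>s\<close> treats bounded and unbounded multipliers at once: the limit of
    \<open>1 / s n = 1 - (\<Sum>i\<in>J. u n i)\<close> vanishes exactly in the unbounded case.\<close>
  define u where "u n i = \<beta> n i / s n" for n i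
  have us: "1 - (\<Sum>i\<in>J. u n i) = 1 / s n" for n
  proof -
    have "(\<Sum>i\<in>J. u n i) = (s n - 1) / s n" by (simp add: u_def s_def sum_divide_distrib)
    then show ?thesis using s[of n] by (simp add: field_simps)
  qed
  have u01: "u n i \<in> {0..1}" if "i \<in> J" for n i
  proof -
    have "\<beta> n i \<le> (\<Sum>i\<in>J. \<beta> n i)" using finJ that \<beta>(1) by (intro member_le_sum) auto
    then show ?thesis using \<beta>(1)[OF that] s[of n] by (auto simp: u_def s_def divide_le_eq)
  qed
  obtain \<psi> l where \<psi>: "strict_mono (\<psi> :: nat \<Rightarrow> nat)" and l: "\<And>i. i \<in> J \<Longrightarrow> (\<lambda>n. u (\<psi> n) i) \<longlonglongrightarrow> l i"
    using bounded_family_subsequence[of J u, OF finJ u01] by blast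
  define \<theta> where "\<theta> = \<phi> \<circ> \<psi>"
  have \<theta>: "strict_mono \<theta>" unfolding \<theta>_def by (rule strict_mono_o[OF \<phi> \<psi>])
  have \<theta>I: "filterlim \<theta> (along I) sequentially"
    by (rule filterlim_along[OF \<theta>]) (simp add: \<theta>_def \<phi>R)
  have \<theta>s: "filterlim \<theta> sequentially sequentially" by (rule filterlim_subseq[OF \<theta>])
  have xl: "(\<lambda>n. x (\<theta> n)) \<longlonglongrightarrow> xbar" by (rule filterlim_compose[OF x \<theta>s])
  have \<delta>l: "(\<lambda>n. \<delta> (\<theta> n)) \<longlonglongrightarrow> 0" by (rule filterlim_compose[OF \<delta> \<theta>s])
  have Nl: "(\<lambda>n. N (\<theta> n)) \<longlonglongrightarrow> H" by (rule filterlim_compose[OF NH \<theta>s])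
  have El: "(\<lambda>n. E (\<theta> n) i) \<longlonglongrightarrow> Ebar i" if "i \<in> J" for i
    by (rule filterlim_compose[OF Ebar \<theta>I]) (use that J in auto)
  have vl: "(\<lambda>n. vdiag G (x (\<theta> n)) (E (\<theta> n)) i) \<longlonglongrightarrow> vdiag G xbar Ebar i" if "i \<in> J" for i
    by (intro tendsto_vdiag assms(3) xl El that)
  have gl: "(\<lambda>n. g (x (\<theta> n))) \<longlonglongrightarrow> g xbar" by (rule isCont_tendsto_compose[OF g(2) xl])
  define \<kappa> where "\<kappa> = 1 - (\<Sum>i\<in>J. l i)"
  have sl: "(\<lambda>n. 1 - (\<Sum>i\<in>J. u (\<psi> n) i)) \<longlonglongrightarrow> \<kappa>"
    unfolding \<kappa>_def by (intro tendsto_diff tendsto_const tendsto_sum l)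
  have \<kappa>: "0 \<le> \<kappa>"
  proof (rule LIMSEQ_le_const[OF sl], intro exI allI impI)
    show "0 \<le> 1 - (\<Sum>i\<in>J. u (\<psi> n) i)" for n unfolding us using s[of "\<psi> n"] by simp
  qed
  have l0: "0 \<le> l i" if "i \<in> J" for i
    by (rule LIMSEQ_le_const[OF l[OF that]]) (use u01[OF that] in auto)
  \<comment> \<open>The AKKT equation divided by \<open>s\<close>, so that every factor
    converges.\<close>
  have eq: "(1 - (\<Sum>i\<in>J. u (\<psi> n) i)) *\<^sub>R (g (x (\<theta> n)) - \<delta> (\<theta> n))
      = (\<Sum>i\<in>J. u (\<psi> n) i *\<^sub>R vdiag G (x (\<theta> n)) (E (\<theta> n)) i)" for n
  proof -
    have "g (x (\<theta> n)) - \<delta> (\<theta> n) = (\<Sum>i\<in>J. \<beta> (\<psi> n) i *\<^sub>R vdiag G (x (\<theta> n)) (E (\<theta> n)) i)"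
      unfolding \<theta>_def o_def \<beta>(4)[of "\<psi> n", symmetric] by simp
    then show ?thesis unfolding us by (simp add: scaleR_sum_right u_def)
  qed
  have lhs: "(\<lambda>n. (1 - (\<Sum>i\<in>J. u (\<psi> n) i)) *\<^sub>R (g (x (\<theta> n)) - \<delta> (\<theta> n))) \<longlonglongrightarrow> \<kappa> *\<^sub>R (g xbar - 0)"
    by (intro tendsto_scaleR tendsto_diff sl gl \<delta>l)
  have rhs: "(\<lambda>n. \<Sum>i\<in>J. u (\<psi> n) i *\<^sub>R vdiag G (x (\<theta> n)) (E (\<theta> n)) i)
      \<longlonglongrightarrow> (\<Sum>i\<in>J. l i *\<^sub>R vdiag G xbar Ebar i)"
    by (intro tendsto_sum tendsto_scaleR l vl)
  have lim: "\<kappa> *\<^sub>R g xbar = (\<Sum>i\<in>J. l i *\<^sub>R vdiag G xbar Ebar i)"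
    using LIMSEQ_unique[OF lhs[unfolded eq] rhs] by simp
  \<comment> \<open>If \<open>\<kappa>\<close> were 0, the \<open>l i\<close> would sum to 1 and
    \<open>lim\<close> would be a positive dependence at \<open>xbar\<close>. Seq-CPLD would then
    contradict the independence recorded in \<open>\<beta>(3)\<close>.\<close>
  have "\<kappa> \<noteq> 0"
  proof
    assume 0: "\<kappa> = 0"
    then have "(\<Sum>i\<in>J. l i) \<noteq> 0" by (simp add: \<kappa>_def)
    then obtain i where "i \<in> J" "l i \<noteq> 0" by (meson sum.neutral)
    then have "pos_lin_dep J (vdiag G xbar Ebar)"
      unfolding pos_lin_dep_def using l0 lim 0 by (intro exI[of _ l]) auto
    from cpld[OF J(1) this] have "\<forall>\<^sub>F n in sequentially. lin_dep J (vdiag G (x (\<theta> n)) (E (\<theta> n)))"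
      using \<theta>I by (rule eventually_compose_filterlim)
    then show False using \<beta>(3) by (auto simp: \<theta>_def)
  qed

  \<comment> \<open>The KKT multiplier\<close>
  with \<kappa> have \<kappa>: "0 < \<kappa>" by simp
  \<comment> \<open>Along \<open>\<psi>\<close> the original coefficients \<open>\<beta>\<close> are
    u divided by 1/s, so they tend to \<open>l i / \<kappa>\<close>.\<close>
  define Yb where "Yb = (\<Sum>i\<in>J. (l i / \<kappa>) *\<^sub>R outer (Ebar i))"
  have Yb: "psd Yb" unfolding Yb_def using l0 \<kappa> by (intro psd_sum_outer) simp
  then have Ybsym: "symmetric_matrix Yb" by (simp add: psd_def)
  have "adjoint (frechet_derivative G (at xbar)) Yb = (1 / \<kappa>) *\<^sub>R (\<Sum>i\<in>J. l i *\<^sub>R vdiag G xbar Ebar i)"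
    unfolding Yb_def adjoint_derivative_sum_outer[OF Gd] by (simp add: scaleR_sum_right)
  also have "\<dots> = g xbar" using \<kappa> by (simp flip: lim)
  finally have grad: "GDERIV (\<lambda>x. lagrangian f G x Yb) xbar :> 0"
    using gderiv_lagrangian[OF g(1) Gd Ybsym] by simp
  \<comment> \<open>Before the limit this value is a negative eigenvalue of the perturbed matrix, so
    the limit is at most 0; semidefiniteness of \<open>H\<close> gives the reverse
    inequality.\<close>
  have "Ebar i \<bullet> (H *v Ebar i) = 0" if i: "i \<in> J" for i
  proof -
    have "(\<lambda>n. E (\<theta> n) i \<bullet> (N (\<theta> n) *v E (\<theta> n) i)) \<longlonglongrightarrow> Ebar i \<bullet> (H *v Ebar i)"
      by (intro tendsto_inner tendsto_matrix_vector_mult Nl El i)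
    moreover have "E (\<theta> n) i \<bullet> (N (\<theta> n) *v E (\<theta> n) i) \<le> 0" for n
      using E[OF \<phi>R(1), of "\<psi> n"] \<beta>(2)[OF i, of "\<psi> n"] i J(1)
      by (auto simp: eigvec_matrices_def S_def \<theta>_def subset_iff)
    ultimately have "Ebar i \<bullet> (H *v Ebar i) \<le> 0" by (intro LIMSEQ_le_const2) auto
    moreover have "0 \<le> Ebar i \<bullet> (H *v Ebar i)" using H by (simp add: psd_def)
    ultimately show ?thesis by linarith
  qed
  then have "G xbar \<bullet> Yb = 0" by (simp add: Yb_def inner_sum_right inner_outer H_def)
  then have "sym_inner (G xbar) Yb = 0" by (simp add: sym_inner_eq_inner[OF Ybsym])
  then show ?thesis using Yb grad assms(4) unfolding kkt_def by blast
qed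

end
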